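(* Let $p>0$ be a prime. Let $R$ be a NIP $\mathbb{F}_p$-algebra such that $R$ is a local ring and an integral domain, with maximal ideal $\mathfrak{m}$, and such that the residue field $R/\mathfrak{m}$ is infinite. Then the map $R\to R$, $x\mapsto x^p-x$, is surjective.
   Context: All rings are commutative and unital. A ring is NIP if its complete theory in the language of rings is NIP. *)

theory Defs
  imports "HOL-Algebra.QuotRing" "HOL-Algebra.Module" "HOL-Number_Theory.Residues"
begin

section \<open>First-order formulas in the language of rings\<close>

datatype ring_term =
    Var nat
  | Zero
  | One
  | Add ring_term ring_term
  | Mul ring_term ring_term
  | Neg ring_term

datatype ring_form =
    FEq ring_term ring_term
  | FNot ring_form
  | FAnd ring_form ring_form
  | FEx nat ring_form

primrec tvars :: "ring_term \<Rightarrow> nat set" where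
  "tvars (Var v) = {v}"
| "tvars Zero = {}"
| "tvars One = {}"
| "tvars (Add s t) = tvars s \<union> tvars t"
| "tvars (Mul s t) = tvars s \<union> tvars t"
| "tvars (Neg t) = tvars t"

primrec fvars :: "ring_form \<Rightarrow> nat set" where
  "fvars (FEq s t) = tvars s \<union> tvars t"
| "fvars (FNot \<phi>) = fvars \<phi>"
| "fvars (FAnd \<phi> \<psi>) = fvars \<phi> \<union> fvars \<psi>"
| "fvars (FEx v \<phi>) = fvars \<phi> - {v}"

primrec tval :: "('a, 'm) ring_scheme \<Rightarrow> (nat \<Rightarrow> 'a) \<Rightarrow> ring_term \<Rightarrow> 'a" where
  "tval M e (Var v) = e v"
| "tval M e Zero = \<zero>\<^bsub>M\<^esub>"
| "tval M e One = \<one>\<^bsub>M\<^esub>"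
| "tval M e (Add s t) = tval M e s \<oplus>\<^bsub>M\<^esub> tval M e t"
| "tval M e (Mul s t) = tval M e s \<otimes>\<^bsub>M\<^esub> tval M e t"
| "tval M e (Neg t) = \<ominus>\<^bsub>M\<^esub> tval M e t"

primrec sat :: "('a, 'm) ring_scheme \<Rightarrow> (nat \<Rightarrow> 'a) \<Rightarrow> ring_form \<Rightarrow> bool" where
  "sat M e (FEq s t) \<longleftrightarrow> tval M e s = tval M e t"
| "sat M e (FNot \<phi>) \<longleftrightarrow> \<not> sat M e \<phi>"
| "sat M e (FAnd \<phi> \<psi>) \<longleftrightarrow> sat M e \<phi> \<and> sat M e \<psi>"
| "sat M e (FEx v \<phi>) \<longleftrightarrow> (\<exists>z\<in>carrier M. sat M (e(v := z)) \<phi>)"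

definition ring_theory :: "('a, 'm) ring_scheme \<Rightarrow> ring_form set" where
  "ring_theory M = {\<phi>. fvars \<phi> = {} \<and> (\<forall>e. sat M e \<phi>)}"

text \<open>
  A structure for the language of rings satisfying the theory of a commutative ring is
  itself a commutative ring, so only such structures are considered as models.
\<close>

definition is_model :: "('a, 'm) ring_scheme \<Rightarrow> ring_form set \<Rightarrow> bool" where
  "is_model M T \<longleftrightarrow> cring M \<and> (\<forall>\<phi>\<in>T. \<forall>e. sat M e \<phi>)"


section \<open>The independence property\<close>

definition tuples :: "('a, 'm) ring_scheme \<Rightarrow> nat \<Rightarrow> 'a list set" where
  "tuples M k = {xs. length xs = k \<and> set xs \<subseteq> carrier M}"

text \<open>
  A partitioned formula \<open>\<phi>(x; y)\<close> with \<open>|x| = k\<close> and \<open>|y| = l\<close> is a formula whose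
  free variables are among \<open>0, \<dots>, k + l - 1\<close>: the first \<open>k\<close> variables form \<open>x\<close>, the
  next \<open>l\<close> form \<open>y\<close>. Thus \<open>sat M ((!) (a @ b)) \<phi>\<close> says that \<open>\<phi>(a; b)\<close> holds
  in \<open>M\<close>; the value of \<open>(!)\<close> beyond the end of the list plays no role.
\<close>

definition has_IP :: "('a, 'm) ring_scheme \<Rightarrow> ring_form \<Rightarrow> nat \<Rightarrow> nat \<Rightarrow> bool" where
  "has_IP M \<phi> k l \<longleftrightarrow>
     (\<forall>n::nat. \<exists>a. (\<forall>i<n. a i \<in> tuples M k) \<and>
        (\<forall>S. S \<subseteq> {..<n} \<longrightarrow>
           (\<exists>b\<in>tuples M l. \<forall>i<n. sat M ((!) (a i @ b)) \<phi> \<longleftrightarrow> i \<in> S)))"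

text \<open>
  A complete theory is NIP if no partitioned formula has the independence property in a
  model of it. As this is formulated by patterns of every finite size \<open>n\<close>, each of which
  is expressed by a sentence, all models of a complete theory agree about it; hence nothing
  is lost by restricting to models with elements in one type, as long as there is one.
\<close>

definition NIP_theory :: "'a itself \<Rightarrow> ring_form set \<Rightarrow> bool" where
  "NIP_theory (_ :: 'a itself) T \<longleftrightarrow>
     (\<forall>M :: 'a ring. is_model M T \<longrightarrow>
        (\<forall>\<phi> k l. fvars \<phi> \<subseteq> {..<k + l} \<longrightarrow> \<not> has_IP M \<phi> k l))"

definition NIP_ring :: "('a, 'm) ring_scheme \<Rightarrow> bool" where
  "NIP_ring R \<longleftrightarrow> cring R \<and> NIP_theory TYPE('a) (ring_theory R)"


section \<open>Local rings\<close>

definition local_ring :: "('a, 'm) ring_scheme \<Rightarrow> bool" where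
  "local_ring R \<longleftrightarrow> cring R \<and> (\<exists>!\<mm>. maximalideal \<mm> R)"

end

theory Submission
  imports Defs "HOL-Algebra.Polynomial_Divisibility"
begin

text \<open>
  Write \<open>G = {x^p - x}\<close>. By NIP (Baldwin--Saxl), for some \<open>n\<close> any \<open>n\<close> of the definable groups
  \<open>{t. c t \<in> G}\<close> contain a redundant one. Choose \<open>\<beta>_i\<close> in \<open>R\<close> whose residues are independent
  over \<open>{a. a^p = a}\<close>, and let \<open>c\<close> generate the solutions \<open>d\<close> of
  \<open>\<Sum>i. \<beta>_i^(p^k) d_i = 0\<close>, \<open>0 < k < n\<close>. These equations say that \<open>x_i^p - x_i = t c_i\<close> for some
  \<open>t\<close> as soon as \<open>\<Sum>i. \<beta>_i^(p^k) x_i = z^(p^k)\<close> for \<open>k < n\<close>, so \<open>z\<close> parametrises the intersection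
  of the groups. Omitting the index \<open>j\<close> replaces \<open>\<beta>_i\<close> by \<open>\<beta>_i^p - \<beta>_j^(p-1) \<beta>_i\<close> and the
  parameter \<open>z\<close> by \<open>z^p - \<beta>_j^(p-1) z\<close>; redundancy of the \<open>j\<close>-th group thus makes
  \<open>z \<mapsto> z^p - \<beta>_j^(p-1) z\<close> surjective, and rescaling by the unit \<open>\<beta>_j\<close> gives the claim.
\<close>

section \<open>Rings of prime characteristic\<close>

lemma (in cring) binomial_expansion:
  assumes [simp]: "a \<in> carrier R" "b \<in> carrier R"
  shows "(a \<oplus> b) [^] (n::nat) = (\<Oplus>k\<in>{..n}. [(n choose k)] \<cdot> (a [^] k \<otimes> b [^] (n - k)))"
proof (induction n)
  case 0
  then show ?case by simp
next
  case (Suc n)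
  let ?f = "\<lambda>n k. [(n choose k)] \<cdot> (a [^] k \<otimes> b [^] (n - k))"
  have mb: "?f n k \<otimes> b = [(n choose k)] \<cdot> (a [^] k \<otimes> b [^] (Suc n - k))" if "k \<le> n" for k
    using that by (simp add: add_pow_ldistr m_assoc Suc_diff_le)
  have ma: "?f n k \<otimes> a = [(n choose k)] \<cdot> (a [^] Suc k \<otimes> b [^] (Suc n - Suc k))" for k
    by (simp add: add_pow_ldistr m_assoc) (simp add: m_comm)
  \<comment> \<open>The summand for \<open>k = Suc n\<close> vanishes with its binomial coefficient;
    adding it and splitting off \<open>k = 0\<close> aligns the powers for Pascal's rule.\<close>
  have "(\<Oplus>k\<in>{..n}. [(n choose k)] \<cdot> (a [^] k \<otimes> b [^] (Suc n - k)))
      = (\<Oplus>k\<in>{..Suc n}. [(n choose k)] \<cdot> (a [^] k \<otimes> b [^] (Suc n - k)))"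
    by (subst finsum_Suc) (auto simp: binomial_eq_0)
  also have "\<dots> = (\<Oplus>k\<in>{..n}. [(n choose Suc k)] \<cdot> (a [^] Suc k \<otimes> b [^] (Suc n - Suc k))) \<oplus> ?f (Suc n) 0"
    by (subst finsum_Suc2) auto
  finally have *: "(\<Oplus>k\<in>{..n}. ?f n k \<otimes> b) =
     (\<Oplus>k\<in>{..n}. [(n choose Suc k)] \<cdot> (a [^] Suc k \<otimes> b [^] (Suc n - Suc k))) \<oplus> ?f (Suc n) 0"
    using mb by (simp cong: finsum_cong)
  have "(a \<oplus> b) [^] Suc n = (\<Oplus>k\<in>{..n}. ?f n k) \<otimes> (a \<oplus> b)"
    using Suc by simp
  also have "\<dots> = (\<Oplus>k\<in>{..n}. ?f n k \<otimes> a) \<oplus> (\<Oplus>k\<in>{..n}. ?f n k \<otimes> b)"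
    by (subst r_distr) (auto simp: finsum_ldistr)
  also have "\<dots> = ((\<Oplus>k\<in>{..n}. [(n choose k)] \<cdot> (a [^] Suc k \<otimes> b [^] (Suc n - Suc k)))
       \<oplus> (\<Oplus>k\<in>{..n}. [(n choose Suc k)] \<cdot> (a [^] Suc k \<otimes> b [^] (Suc n - Suc k)))) \<oplus> ?f (Suc n) 0"
    unfolding * ma by (rule a_assoc[symmetric]) auto
  also have "\<dots> = (\<Oplus>k\<in>{..n}. ?f (Suc n) (Suc k)) \<oplus> ?f (Suc n) 0"
    by (subst finsum_addf[symmetric]) (auto simp: add.nat_pow_mult)
  also have "\<dots> = (\<Oplus>k\<in>{..Suc n}. ?f (Suc n) k)"
    by (rule finsum_Suc2[symmetric]) auto
  finally show ?case .
qed

lemma (in ring) add_eq_imp_eq_minus: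
  assumes "x \<oplus> y = z" "x \<in> carrier R" "y \<in> carrier R"
  shows "x = z \<ominus> y"
  using assms by (auto simp: a_minus_def a_assoc r_neg)

section \<open>Characteristic p and additivity of the Frobenius map\<close>

locale prime_char_cring = cring R for R (structure) +
  fixes p :: nat
  assumes prime_p: "Factorial_Ring.prime p" and char_p: "[p] \<cdot> \<one> = \<zero>"
begin

lemma p_pos [simp]: "0 < p" and p_gt_1: "1 < p"
  using prime_p prime_gt_0_nat prime_gt_1_nat by auto

lemma dvd_add_pow_eq_zero:
  assumes "p dvd n" "x \<in> carrier R"
  shows "[n] \<cdot> x = \<zero>"
proof -
  obtain m where "n = p * m" using assms by auto
  then have "[n] \<cdot> \<one> = [m] \<cdot> ([p] \<cdot> \<one>)"
    by (simp add: add.nat_pow_pow mult.commute)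
  then have "[n] \<cdot> \<one> = \<zero>" by (simp add: char_p)
  then have "([n] \<cdot> \<one>) \<otimes> x = \<zero>" using assms by simp
  then show ?thesis using assms by (simp add: add_pow_ldistr)
qed

lemma frobenius_add:
  assumes [simp]: "x \<in> carrier R" "y \<in> carrier R"
  shows "(x \<oplus> y) [^] p = x [^] p \<oplus> y [^] p"
proof -
  let ?f = "\<lambda>k. [(p choose k)] \<cdot> (x [^] k \<otimes> y [^] (p - k))"
  have "(x \<oplus> y) [^] p = (\<Oplus>k\<in>{..p}. ?f k)"
    by (rule binomial_expansion) auto
  also have "\<dots> = (\<Oplus>k\<in>{0, p}. ?f k)"
  proof (rule add.finprod_mono_neutral_cong_right)
    show "\<And>k. k \<in> {..p} - {0, p} \<Longrightarrow> ?f k = \<zero>"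
      by (intro dvd_add_pow_eq_zero dvd_choose_prime) (auto simp: prime_p)
  qed auto
  also have "\<dots> = x [^] p \<oplus> y [^] p"
    using p_pos by (simp add: a_comm)
  finally show ?thesis .
qed

lemma frobenius_pow_add:
  assumes [simp]: "x \<in> carrier R" "y \<in> carrier R"
  shows "(x \<oplus> y) [^] (p ^ k) = x [^] (p ^ k) \<oplus> y [^] (p ^ k)"
proof (induction k)
  case (Suc k)
  then show ?case by (simp add: mult.commute[of p] nat_pow_pow[symmetric] frobenius_add)
qed simp

text \<open>Additivity applied to \<open>(x \<ominus> y) \<oplus> y\<close> covers all primes at
  once, with no sign of \<open>(-1)^(p^k)\<close> to treat.\<close>

lemma frobenius_pow_minus:
  assumes [simp]: "x \<in> carrier R" "y \<in> carrier R"
  shows "(x \<ominus> y) [^] (p ^ k) = x [^] (p ^ k) \<ominus> y [^] (p ^ k)"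
proof -
  have "x [^] (p ^ k) = (x \<ominus> y) [^] (p ^ k) \<oplus> y [^] (p ^ k)"
    by (simp flip: frobenius_pow_add) (simp add: a_minus_def a_assoc l_neg)
  then show ?thesis by (simp add: a_minus_def a_assoc r_neg)
qed

lemma frobenius_minus:
  assumes "x \<in> carrier R" "y \<in> carrier R"
  shows "(x \<ominus> y) [^] p = x [^] p \<ominus> y [^] p"
  using frobenius_pow_minus[OF assms, of 1] by simp

lemma frobenius_finsum:
  assumes "f \<in> I \<rightarrow> carrier R"
  shows "(\<Oplus>i\<in>I. f i) [^] p = (\<Oplus>i\<in>I. f i [^] p)"
  using assms
proof (induction I rule: infinite_finite_induct)
  case (insert i I)
  then show ?case by (simp add: frobenius_add Pi_def)
qed (auto simp: nat_pow_zero)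

end

section \<open>Moore sums and independence over the Frobenius-fixed elements\<close>

context prime_char_cring
begin

text \<open>Row \<open>k\<close> of the Moore matrix with entries
  \<open>\<beta> i [^] (p ^ k)\<close>, applied to the vector \<open>x\<close>.\<close>

definition moore_sum :: "nat \<Rightarrow> ('i \<Rightarrow> 'a) \<Rightarrow> ('i \<Rightarrow> 'a) \<Rightarrow> 'i set \<Rightarrow> 'a" where
  "moore_sum k \<beta> x I = (\<Oplus>i\<in>I. \<beta> i [^] (p ^ k) \<otimes> x i)"

text \<open>The additive polynomial X^p - b^(p-1) X, evaluated at \<open>\<beta> i\<close>. It kills
  \<open>b\<close>, and so removes the column of \<open>b\<close> from a Moore matrix.\<close>

definition as_reduce :: "'a \<Rightarrow> ('i \<Rightarrow> 'a) \<Rightarrow> 'i \<Rightarrow> 'a" where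
  "as_reduce b \<beta> i = \<beta> i [^] p \<ominus> b [^] (p - 1) \<otimes> \<beta> i"

lemma moore_sum_closed [simp]:
  assumes "\<beta> \<in> I \<rightarrow> carrier R" "x \<in> I \<rightarrow> carrier R"
  shows "moore_sum k \<beta> x I \<in> carrier R"
  using assms unfolding moore_sum_def by (intro finsum_closed) auto

lemma as_reduce_closed [simp]:
  "\<beta> \<in> I \<rightarrow> carrier R \<Longrightarrow> b \<in> carrier R \<Longrightarrow> as_reduce b \<beta> \<in> I \<rightarrow> carrier R"
  unfolding as_reduce_def by auto

lemma moore_sum_remove:
  assumes "finite I" "j \<in> I" "\<beta> \<in> I \<rightarrow> carrier R" "x \<in> I \<rightarrow> carrier R"
  shows "moore_sum k \<beta> x I = \<beta> j [^] (p ^ k) \<otimes> x j \<oplus> moore_sum k \<beta> x (I - {j})"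
proof -
  have "moore_sum k \<beta> x (insert j (I - {j})) = \<beta> j [^] (p ^ k) \<otimes> x j \<oplus> moore_sum k \<beta> x (I - {j})"
    unfolding moore_sum_def using assms by (subst finsum_insert) auto
  then show ?thesis using assms by (simp add: insert_absorb)
qed

lemma moore_sum_cong:
  assumes "\<And>i. i \<in> I \<Longrightarrow> x i = y i" "\<beta> \<in> I \<rightarrow> carrier R" "y \<in> I \<rightarrow> carrier R"
  shows "moore_sum k \<beta> x I = moore_sum k \<beta> y I"
  unfolding moore_sum_def using assms by (intro finsum_cong') auto

lemma moore_sum_minus:
  assumes "\<beta> \<in> I \<rightarrow> carrier R" "x \<in> I \<rightarrow> carrier R" "y \<in> I \<rightarrow> carrier R"
  shows "moore_sum k \<beta> (\<lambda>i. x i \<ominus> y i) I = moore_sum k \<beta> x I \<ominus> moore_sum k \<beta> y I"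
proof -
  have "moore_sum k \<beta> (\<lambda>i. x i \<ominus> y i) I \<oplus> moore_sum k \<beta> y I = moore_sum k \<beta> x I"
  proof -
    have "(\<Oplus>i\<in>I. \<beta> i [^] (p ^ k) \<otimes> (x i \<ominus> y i)) \<oplus> (\<Oplus>i\<in>I. \<beta> i [^] (p ^ k) \<otimes> y i)
        = (\<Oplus>i\<in>I. \<beta> i [^] (p ^ k) \<otimes> (x i \<ominus> y i) \<oplus> \<beta> i [^] (p ^ k) \<otimes> y i)"
      using assms by (intro finsum_addf[symmetric]) (auto simp: Pi_iff)
    also have "\<dots> = (\<Oplus>i\<in>I. \<beta> i [^] (p ^ k) \<otimes> x i)"
      using assms by (intro finsum_cong')
        (auto simp: Pi_iff a_minus_def a_assoc l_neg simp flip: r_distr)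
    finally show ?thesis unfolding moore_sum_def .
  qed
  moreover have "moore_sum k \<beta> (\<lambda>i. x i \<ominus> y i) I \<in> carrier R"
    using assms by (intro moore_sum_closed) auto
  ultimately show ?thesis
    using assms by (intro add_eq_imp_eq_minus moore_sum_closed) auto
qed

text \<open>Frobenius is additive and shifts the rows of the Moore matrix by one.\<close>

lemma moore_sum_frobenius:
  assumes "\<beta> \<in> I \<rightarrow> carrier R" "x \<in> I \<rightarrow> carrier R"
  shows "moore_sum (Suc k) \<beta> (\<lambda>i. x i [^] p) I = moore_sum k \<beta> x I [^] p"
  unfolding moore_sum_def using assms
  by (subst frobenius_finsum)
    (auto intro!: finsum_cong' simp: Pi_iff nat_pow_distrib nat_pow_pow mult.commute)

text \<open>Elimination of the unknown \<open>x j\<close>: as Frobenius powers are additive,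
  \<open>as_reduce\<close> turns row \<open>k\<close> into row \<open>Suc k\<close> minus a multiple
  of row \<open>k\<close>, and column \<open>j\<close> becomes zero.\<close>

lemma moore_sum_as_reduce:
  assumes fin: "finite I" and j: "j \<in> I" and \<beta>: "\<beta> \<in> I \<rightarrow> carrier R" and x: "x \<in> I \<rightarrow> carrier R"
  shows "moore_sum k (as_reduce (\<beta> j) \<beta>) x (I - {j}) =
    moore_sum (Suc k) \<beta> x I \<ominus> (\<beta> j [^] (p - 1)) [^] (p ^ k) \<otimes> moore_sum k \<beta> x I"
proof -
  let ?c = "\<beta> j [^] (p - 1)"
  have c [simp]: "?c \<in> carrier R" "\<beta> j \<in> carrier R" using \<beta> j by auto
  have "?c \<otimes> \<beta> j = \<beta> j [^] p"
    using p_pos nat_pow_Suc[of "\<beta> j" "p - 1"] by simp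
  then have j0: "as_reduce (\<beta> j) \<beta> j = \<zero>"
    by (simp add: as_reduce_def)
  have red: "as_reduce (\<beta> j) \<beta> \<in> I \<rightarrow> carrier R"
    using \<beta> by simp
  have "moore_sum k (as_reduce (\<beta> j) \<beta>) x (I - {j}) = moore_sum k (as_reduce (\<beta> j) \<beta>) x I"
    using fin j x red j0 by (subst moore_sum_remove[of I j]) (auto simp: nat_pow_zero Pi_iff)
  moreover have "moore_sum k (as_reduce (\<beta> j) \<beta>) x I \<oplus> ?c [^] (p ^ k) \<otimes> moore_sum k \<beta> x I
      = moore_sum (Suc k) \<beta> x I"
  proof -
    have "moore_sum k (as_reduce (\<beta> j) \<beta>) x I \<oplus> ?c [^] (p ^ k) \<otimes> moore_sum k \<beta> x I =
       (\<Oplus>i\<in>I. as_reduce (\<beta> j) \<beta> i [^] (p ^ k) \<otimes> x i \<oplus> ?c [^] (p ^ k) \<otimes> (\<beta> i [^] (p ^ k) \<otimes> x i))"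
      unfolding moore_sum_def using fin \<beta> x red
      by (subst finsum_rdistr, simp, simp, force, subst finsum_addf[symmetric]) (auto simp: Pi_iff)
    also have "\<dots> = moore_sum (Suc k) \<beta> x I"
      unfolding moore_sum_def
    proof (intro finsum_cong' refl)
      fix i assume i: "i \<in> I"
      have [simp]: "\<beta> i \<in> carrier R" "x i \<in> carrier R" using i \<beta> x by auto
      have "as_reduce (\<beta> j) \<beta> i [^] (p ^ k) \<otimes> x i \<oplus> ?c [^] (p ^ k) \<otimes> (\<beta> i [^] (p ^ k) \<otimes> x i)
         = (as_reduce (\<beta> j) \<beta> i [^] (p ^ k) \<oplus> (?c \<otimes> \<beta> i) [^] (p ^ k)) \<otimes> x i"
        using red i by (subst l_distr) (auto simp: nat_pow_distrib m_assoc)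
      also have "as_reduce (\<beta> j) \<beta> i [^] (p ^ k) \<oplus> (?c \<otimes> \<beta> i) [^] (p ^ k) = (\<beta> i [^] p) [^] (p ^ k)"
        using red i by (subst frobenius_pow_add[symmetric])
          (auto simp: as_reduce_def a_minus_def a_assoc l_neg)
      finally show "as_reduce (\<beta> j) \<beta> i [^] (p ^ k) \<otimes> x i \<oplus> ?c [^] (p ^ k) \<otimes> (\<beta> i [^] (p ^ k) \<otimes> x i)
         = \<beta> i [^] (p ^ Suc k) \<otimes> x i"
        by (simp add: nat_pow_pow)
    qed (use \<beta> x in auto)
    finally show ?thesis .
  qed
  moreover have "moore_sum k (as_reduce (\<beta> j) \<beta>) x I \<in> carrier R" "moore_sum k \<beta> x I \<in> carrier R"
    using red \<beta> x by auto
  ultimately show ?thesis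
    by (metis add_eq_imp_eq_minus c(1) m_closed nat_pow_closed)
qed

text \<open>In a field of characteristic p the solutions of \<open>x [^] p = x\<close> form the
  prime field, so there this is linear independence over it; the equation spares an embedding of
  that field.\<close>

definition fp_indep :: "('i \<Rightarrow> 'a) \<Rightarrow> 'i set \<Rightarrow> bool" where
  "fp_indep b I \<longleftrightarrow> (\<forall>a \<in> I \<rightarrow> {x \<in> carrier R. x [^] p = x}.
     (\<Oplus>i\<in>I. a i \<otimes> b i) = \<zero> \<longrightarrow> (\<forall>i\<in>I. a i = \<zero>))"

lemma fp_indep_cong:
  assumes "fp_indep b I" "\<And>i. i \<in> I \<Longrightarrow> b' i = b i" "b \<in> I \<rightarrow> carrier R"
  shows "fp_indep b' I"
  unfolding fp_indep_def
proof (intro ballI impI)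
  fix a i
  assume a: "a \<in> I \<rightarrow> {x \<in> carrier R. x [^] p = x}" and 0: "(\<Oplus>i\<in>I. a i \<otimes> b' i) = \<zero>" and i: "i \<in> I"
  have "(\<Oplus>i\<in>I. a i \<otimes> b i) = (\<Oplus>i\<in>I. a i \<otimes> b' i)"
    using a assms(2,3) by (intro finsum_cong') (auto simp: Pi_iff)
  then show "a i = \<zero>"
    using assms(1) a 0 i unfolding fp_indep_def by auto
qed

end

section \<open>Independent families in a field of characteristic p\<close>

lemma (in field) finite_frobenius_fixed:
  assumes "1 < p"
  shows "finite {x \<in> carrier R. x [^] (p::nat) = x}"
proof -
  \<comment> \<open>The coefficients of X^p - X, leading coefficient first; a nonzero polynomial has
    finitely many roots.\<close>
  define f where "f = \<one> # replicate (p - 2) \<zero> @ [\<ominus> \<one>, \<zero>]"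
  have f: "f \<in> carrier (poly_ring R)"
    unfolding f_def univ_poly_carrier[symmetric] polynomial_def by auto
  have ev: "eval (replicate n \<zero> @ q) x = eval q x" if "set q \<subseteq> carrier R" "x \<in> carrier R" for n q x
    using that by (induction n) (auto simp: eval_in_carrier)
  have "eval f x = x [^] p \<oplus> \<ominus> x" if "x \<in> carrier R" for x
  proof -
    have "Suc (Suc (p - 2)) = p" using assms by simp
    then show ?thesis using that by (simp add: f_def ev l_minus)
  qed
  then have "{x \<in> carrier R. x [^] p = x} \<subseteq> {x. is_root f x}"
    by (auto simp: is_root_def f_def r_neg)
  then show ?thesis
    using finite_number_of_roots[OF f] finite_subset by blast
qed

locale prime_char_field = prime_char_cring + field
begin

lemma frobenius_fixed_minus:
  assumes "w \<in> carrier R" "w [^] p = w"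
  shows "(\<ominus> w) [^] p = \<ominus> w"
  using frobenius_minus[of \<zero> w] assms by (simp add: a_minus_def nat_pow_zero)

lemma fp_indep_nonzero:
  assumes "fp_indep b I" "finite I" "j \<in> I" "b \<in> I \<rightarrow> carrier R"
  shows "b j \<noteq> \<zero>"
proof
  assume bj: "b j = \<zero>"
  let ?a = "\<lambda>i. if i = j then \<one> else \<zero>"
  have "(\<Oplus>i\<in>I. ?a i \<otimes> b i) = \<zero>"
    using assms bj by (intro add.finprod_one_eqI) (auto simp: Pi_iff)
  moreover have "?a \<in> I \<rightarrow> {x \<in> carrier R. x [^] p = x}"
    by (auto simp: nat_pow_zero)
  ultimately have "\<forall>i\<in>I. ?a i = \<zero>"
    by (intro assms(1)[unfolded fp_indep_def, rule_format, of ?a] ballI)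
  then show False using assms(3) by auto
qed

text \<open>With \<open>v\<close> the sum of the \<open>a i \<otimes> b i\<close>, a relation among
  the reduced elements reads \<open>v [^] p = b j [^] (p - 1) \<otimes> v\<close>. Hence
  \<open>v\<close> is \<open>b j\<close> times a Frobenius-fixed \<open>w\<close>, which is a
  relation among the original \<open>b\<close>.\<close>

lemma fp_indep_as_reduce:
  assumes ind: "fp_indep b I" and fin: "finite I" and j: "j \<in> I" and b: "b \<in> I \<rightarrow> carrier R"
  shows "fp_indep (as_reduce (b j) b) (I - {j})"
  unfolding fp_indep_def
proof (intro ballI impI)
  fix a i
  assume a: "a \<in> I - {j} \<rightarrow> {x \<in> carrier R. x [^] p = x}"
    and sum0: "(\<Oplus>i\<in>I - {j}. a i \<otimes> as_reduce (b j) b i) = \<zero>" and i: "i \<in> I - {j}"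
  have bj [simp]: "b j \<in> carrier R" using b j by auto
  have bj0: "b j \<noteq> \<zero>" using assms by (rule fp_indep_nonzero)
  define c where "c = b j [^] (p - 1)"
  have c [simp]: "c \<in> carrier R" by (simp add: c_def)
  define v where "v = (\<Oplus>i\<in>I - {j}. a i \<otimes> b i)"
  have v [simp]: "v \<in> carrier R"
    unfolding v_def using a b by (intro finsum_closed) auto
  \<comment> \<open>As \<open>a i\<close> is fixed by Frobenius, adding \<open>c \<otimes> v\<close>
    turns each summand into \<open>(a i \<otimes> b i) [^] p\<close>.\<close>
  have "(\<Oplus>i\<in>I - {j}. a i \<otimes> as_reduce (b j) b i) \<oplus> c \<otimes> v
      = (\<Oplus>i\<in>I - {j}. a i \<otimes> as_reduce (b j) b i \<oplus> c \<otimes> (a i \<otimes> b i))"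
    unfolding v_def using fin a b
    by (subst finsum_rdistr, simp, simp, force, subst finsum_addf[symmetric])
      (auto simp: Pi_iff as_reduce_def)
  also have "\<dots> = (\<Oplus>i\<in>I - {j}. (a i \<otimes> b i) [^] p)"
  proof (intro finsum_cong' refl)
    fix i assume "i \<in> I - {j}"
    then have [simp]: "a i \<in> carrier R" "b i \<in> carrier R" "a i [^] p = a i" using a b by auto
    have "a i \<otimes> as_reduce (b j) b i \<oplus> c \<otimes> (a i \<otimes> b i) = a i \<otimes> (as_reduce (b j) b i \<oplus> c \<otimes> b i)"
      by (simp add: r_distr as_reduce_def m_lcomm)
    also have "as_reduce (b j) b i \<oplus> c \<otimes> b i = b i [^] p"
      by (simp add: as_reduce_def c_def a_minus_def a_assoc l_neg)
    finally show "a i \<otimes> as_reduce (b j) b i \<oplus> c \<otimes> (a i \<otimes> b i) = (a i \<otimes> b i) [^] p"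
      by (simp add: nat_pow_distrib)
  qed (use a b in auto)
  also have "\<dots> = v [^] p"
    unfolding v_def using a b by (intro frobenius_finsum[symmetric]) auto
  finally have vp: "v [^] p = c \<otimes> v" using sum0 by simp
  define w where "w = v \<otimes> inv (b j)"
  have ib [simp]: "b j \<in> Units R" using bj0 by (simp add: field_Units)
  then have w [simp]: "w \<in> carrier R" by (simp add: w_def)
  have wv: "w \<otimes> b j = v" by (simp add: w_def m_assoc)
  have cb: "c \<otimes> b j = b j [^] p"
    using p_pos nat_pow_Suc[of "b j" "p - 1"] by (simp add: c_def)
  have "w [^] p \<otimes> b j [^] p = v [^] p"
    by (simp add: wv flip: nat_pow_distrib)
  also have "\<dots> = c \<otimes> (w \<otimes> b j)"
    by (simp only: vp wv)
  also have "\<dots> = w \<otimes> (c \<otimes> b j)"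
    by (rule m_lcomm) auto
  also have "\<dots> = w \<otimes> b j [^] p"
    by (simp only: cb)
  finally have wp: "w [^] p = w"
    using Units_pow_closed[OF ib, of p] by (subst (asm) m_rcancel) (auto simp: field_Units)
  define a' where "a' = a(j := \<ominus> w)"
  have "a' \<in> I \<rightarrow> {x \<in> carrier R. x [^] p = x}"
    using a wp by (auto simp: a'_def frobenius_fixed_minus)
  moreover have "(\<Oplus>i\<in>I. a' i \<otimes> b i) = \<zero>"
  proof -
    have "(\<Oplus>i\<in>insert j (I - {j}). a' i \<otimes> b i) = a' j \<otimes> b j \<oplus> (\<Oplus>i\<in>I - {j}. a' i \<otimes> b i)"
      using fin a b by (intro finsum_insert) (auto simp: a'_def Pi_iff)
    also have "(\<Oplus>i\<in>I - {j}. a' i \<otimes> b i) = v"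
      unfolding v_def using a b by (intro finsum_cong') (auto simp: a'_def)
    also have "a' j \<otimes> b j \<oplus> v = \<zero>"
      by (simp add: a'_def l_minus wv l_neg)
    finally show ?thesis using j by (simp add: insert_absorb)
  qed
  ultimately have "a' i = \<zero>" using ind i unfolding fp_indep_def by blast
  then show "a i = \<zero>" using i by (simp add: a'_def)
qed

text \<open>There are finitely many fixed elements, hence finitely many combinations of the
  \<open>b i\<close>; an infinite field has a \<open>c\<close> that is none of them.\<close>

lemma fp_indep_extend:
  assumes inf: "infinite (carrier R)" and ind: "fp_indep b I" and fin: "finite I"
    and j: "j \<notin> I" and b: "b \<in> I \<rightarrow> carrier R"
  shows "\<exists>c\<in>carrier R. fp_indep (b(j := c)) (insert j I)"
proof -
  define F where "F = {x \<in> carrier R. x [^] p = x}"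
  have finF: "finite F" unfolding F_def using p_gt_1 by (rule finite_frobenius_fixed)
  \<comment> \<open>Extensional functions, so that there are only finitely many coefficient
    families.\<close>
  define S where "S = (\<lambda>a. \<Oplus>i\<in>I. a i \<otimes> b i) ` (I \<rightarrow>\<^sub>E F)"
  have "finite S" unfolding S_def using fin finF by (intro finite_imageI finite_PiE) auto
  then obtain c where c: "c \<in> carrier R" "c \<notin> S"
    using inf by (meson finite_subset subsetI)
  have "fp_indep (b(j := c)) (insert j I)"
    unfolding fp_indep_def F_def[symmetric]
  proof (intro ballI impI)
    fix a i
    assume a: "a \<in> insert j I \<rightarrow> F" and i: "i \<in> insert j I"
      and sum0: "(\<Oplus>i\<in>insert j I. a i \<otimes> (b(j := c)) i) = \<zero>"
    define v where "v = (\<Oplus>i\<in>I. a i \<otimes> b i)"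
    have v [simp]: "v \<in> carrier R"
      unfolding v_def using a b by (intro finsum_closed) (auto simp: F_def)
    have aj [simp]: "a j \<in> carrier R" "a j [^] p = a j" using a by (auto simp: F_def)
    have "(\<Oplus>i\<in>insert j I. a i \<otimes> (b(j := c)) i) = a j \<otimes> c \<oplus> (\<Oplus>i\<in>I. a i \<otimes> (b(j := c)) i)"
      using fin a b j c by (subst finsum_insert) (auto simp: F_def Pi_iff)
    also have "(\<Oplus>i\<in>I. a i \<otimes> (b(j := c)) i) = v"
      unfolding v_def using a b j c by (intro finsum_cong') (auto simp: F_def Pi_iff)
    finally have eq: "a j \<otimes> c \<oplus> v = \<zero>" using sum0 by simp
    have aj0: "a j = \<zero>"
    proof (rule ccontr)
      assume "a j \<noteq> \<zero>"
      then have u [simp]: "a j \<in> Units R" by (simp add: field_Units)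
      \<comment> \<open>A relation with \<open>a j \<noteq> \<zero>\<close> can be solved for
        \<open>c\<close>; \<open>e\<close> is the resulting factor, again fixed by Frobenius, so
        \<open>c\<close> would lie in \<open>S\<close>.\<close>
      define e where "e = \<ominus> (inv (a j))"
      have e: "e \<in> F"
      proof -
        have "inv (a j) [^] p = inv (a j)"
        proof (rule comm_inv_char[symmetric])
          have "(a j \<otimes> inv (a j)) [^] p = \<one>" by simp
          then show "a j \<otimes> inv (a j) [^] p = \<one>"
            by (subst (asm) nat_pow_distrib) auto
        qed auto
        then show ?thesis by (simp add: e_def F_def frobenius_fixed_minus)
      qed
      then have [simp]: "e \<in> carrier R" by (simp add: F_def)
      have "a j \<otimes> c = \<ominus> v" using eq c by (simp add: sum_zero_eq_neg)
      then have "c = inv (a j) \<otimes> (\<ominus> v)"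
        using c by (metis Units_inv_closed Units_l_inv aj(1) l_one m_assoc u)
      also have "\<dots> = e \<otimes> v" by (simp add: e_def l_minus r_minus)
      also have "\<dots> = (\<Oplus>i\<in>I. e \<otimes> (a i \<otimes> b i))"
        unfolding v_def using fin a b by (intro finsum_rdistr) (auto simp: F_def)
      also have "\<dots> = (\<Oplus>i\<in>I. restrict (\<lambda>i. e \<otimes> a i) I i \<otimes> b i)"
        using a b by (intro finsum_cong') (auto simp: F_def Pi_iff m_assoc)
      finally have "c = (\<Oplus>i\<in>I. restrict (\<lambda>i. e \<otimes> a i) I i \<otimes> b i)" .
      moreover have "restrict (\<lambda>i. e \<otimes> a i) I \<in> I \<rightarrow>\<^sub>E F"
        using a e by (auto simp: F_def Pi_iff nat_pow_distrib)
      ultimately show False using c unfolding S_def by blast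
    qed
    then have "v = \<zero>" using eq c by simp
    then have "\<forall>i\<in>I. a i = \<zero>"
      using ind a unfolding fp_indep_def F_def[symmetric] v_def by auto
    then show "a i = \<zero>" using i aj0 by auto
  qed
  then show ?thesis using c by blast
qed

lemma exists_fp_indep:
  assumes "infinite (carrier R)"
  shows "\<exists>b. b \<in> {..<n} \<rightarrow> carrier R \<and> fp_indep b {..<n::nat}"
proof (induction n)
  case 0
  then show ?case by (simp add: fp_indep_def)
next
  case (Suc n)
  then obtain b where b: "b \<in> {..<n} \<rightarrow> carrier R" "fp_indep b {..<n}" by blast
  obtain c where "c \<in> carrier R" "fp_indep (b(n := c)) (insert n {..<n})"
    using fp_indep_extend[OF assms b(2) _ _ b(1), of n] by auto
  then show ?case
    using b by (intro exI[of _ "b(n := c)"] conjI) (auto simp: lessThan_Suc simp del: fun_upd_apply, auto)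
qed

end

section \<open>Moore systems over a local ring\<close>

text \<open>\<open>R\<close> stands for the local ring and \<open>h\<close> for its residue map to
  the field \<open>S\<close>; locality enters as the statement that elements with nonzero residue
  are units.\<close>

locale residue_char_p = prime_char_cring R p + S: prime_char_field S p + ring_hom_cring R S h
  for R (structure) and S (structure) and p and h +
  assumes unit_lift: "x \<in> carrier R \<Longrightarrow> h x \<noteq> \<zero>\<^bsub>S\<^esub> \<Longrightarrow> x \<in> Units R"
begin

abbreviation lifts_indep :: "('i \<Rightarrow> 'a) \<Rightarrow> 'i set \<Rightarrow> bool" where
  "lifts_indep \<beta> I \<equiv> \<beta> \<in> I \<rightarrow> carrier R \<and> S.fp_indep (h \<circ> \<beta>) I"

text \<open>Independence forces nonzero residues; these units serve as pivots when Moore systems are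
  solved.\<close>

lemma lifts_indep_unit:
  assumes "lifts_indep \<beta> I" "finite I" "j \<in> I"
  shows "\<beta> j \<in> Units R"
  using assms S.fp_indep_nonzero[of "h \<circ> \<beta>" I j] by (intro unit_lift) (auto simp: Pi_iff)

text \<open>\<open>h\<close> commutes with \<open>as_reduce\<close>, so independence after reduction
  can be tested in \<open>S\<close>; this carries the inductions on \<open>I\<close> below.\<close>

lemma lifts_indep_as_reduce:
  assumes ind: "lifts_indep \<beta> I" and fin: "finite I" and j: "j \<in> I"
  shows "lifts_indep (as_reduce (\<beta> j) \<beta>) (I - {j})"
proof -
  have \<beta>: "\<beta> \<in> I \<rightarrow> carrier R" using ind by simp
  have j': "\<beta> j \<in> carrier R" using \<beta> j by auto
  have h\<beta>: "h \<circ> \<beta> \<in> I \<rightarrow> carrier S" using \<beta> by (auto simp: Pi_iff)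
  have eq: "(h \<circ> as_reduce (\<beta> j) \<beta>) i = S.as_reduce ((h \<circ> \<beta>) j) (h \<circ> \<beta>) i" if "i \<in> I" for i
  proof -
    have "\<beta> i \<in> carrier R" using \<beta> that by auto
    then show ?thesis using j'
      by (simp add: as_reduce_def S.as_reduce_def a_minus_def hom_nat_pow)
  qed
  have "S.fp_indep (S.as_reduce ((h \<circ> \<beta>) j) (h \<circ> \<beta>)) (I - {j})"
    by (rule S.fp_indep_as_reduce[OF conjunct2[OF ind] fin j h\<beta>])
  then have "S.fp_indep (h \<circ> as_reduce (\<beta> j) \<beta>) (I - {j})"
  proof (rule S.fp_indep_cong)
    have "(h \<circ> \<beta>) j \<in> carrier S" using j' by simp
    from S.as_reduce_closed[OF h\<beta> this]
    show "S.as_reduce ((h \<circ> \<beta>) j) (h \<circ> \<beta>) \<in> I - {j} \<rightarrow> carrier S"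
      by blast
  qed (rule eq, blast)
  moreover have "as_reduce (\<beta> j) \<beta> \<in> I - {j} \<rightarrow> carrier R"
    using as_reduce_closed[OF \<beta> j'] by auto
  ultimately show ?thesis by simp
qed

text \<open>Eliminating \<open>x j\<close> leaves the Moore system of
  \<open>as_reduce (\<beta> j) \<beta>\<close> on the other indices, with one row fewer and with
  \<open>y\<close> replaced by
  \<open>y [^] p \<ominus> \<beta> j [^] (p - 1) \<otimes> y\<close>.\<close>

lemma moore_system_solvable:
  assumes "finite I" "lifts_indep \<beta> I" "y \<in> carrier R"
  shows "\<exists>x \<in> I \<rightarrow> carrier R. \<forall>k < card I. moore_sum k \<beta> x I = y [^] (p ^ k)"
  using assms
proof (induction I arbitrary: \<beta> y rule: finite_induct)
  case empty
  then show ?case by simp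
next
  case (insert j J)
  let ?I = "insert j J" and ?b = "\<beta> j" and ?\<gamma> = "as_reduce (\<beta> j) \<beta>" and ?c = "\<beta> j [^] (p - 1)"
  have \<beta>: "\<beta> \<in> ?I \<rightarrow> carrier R" using insert by simp
  have u [simp]: "?b \<in> Units R" using lifts_indep_unit[OF insert.prems(1), of j] insert.hyps by simp
  then have b [simp]: "?b \<in> carrier R" by (rule Units_closed)
  have [simp]: "y \<in> carrier R" by fact
  have J: "?I - {j} = J" using insert.hyps by auto
  have \<gamma>: "lifts_indep ?\<gamma> J"
    using lifts_indep_as_reduce[OF insert.prems(1), of j] insert.hyps J by auto
  obtain x where x: "x \<in> J \<rightarrow> carrier R"
    and xs: "\<And>k. k < card J \<Longrightarrow> moore_sum k ?\<gamma> x J = (y [^] p \<ominus> ?c \<otimes> y) [^] (p ^ k)"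
    using insert.IH[OF \<gamma>, of "y [^] p \<ominus> ?c \<otimes> y"] by auto
  have s [simp]: "moore_sum 0 \<beta> x J \<in> carrier R" using x \<beta> by auto
  \<comment> \<open>The entry at \<open>j\<close> is the one that makes row 0 hold, the pivot
    \<open>\<beta> j\<close> being a unit.\<close>
  define x' where "x' = x(j := inv ?b \<otimes> (y \<ominus> moore_sum 0 \<beta> x J))"
  have x': "x' \<in> ?I \<rightarrow> carrier R"
    using x by (auto simp: x'_def)
  have x'J: "moore_sum k \<delta> x' J = moore_sum k \<delta> x J" if "\<delta> \<in> J \<rightarrow> carrier R" for k \<delta>
    using that x insert.hyps by (intro moore_sum_cong) (auto simp: x'_def)
  \<comment> \<open>Row \<open>Suc k\<close> follows from row \<open>k\<close> and row
    \<open>k\<close> of the reduced system.\<close>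
  have "moore_sum k \<beta> x' ?I = y [^] (p ^ k)" if "k < card ?I" for k
    using that
  proof (induction k)
    case 0
    have "moore_sum 0 \<beta> x' ?I = ?b \<otimes> x' j \<oplus> moore_sum 0 \<beta> x' J"
      using moore_sum_remove[of ?I j \<beta> x' 0] insert.hyps x' \<beta> J by simp
    also have "moore_sum 0 \<beta> x' J = moore_sum 0 \<beta> x J"
      using \<beta> by (intro x'J) auto
    also have "?b \<otimes> x' j = y \<ominus> moore_sum 0 \<beta> x J"
      by (simp add: x'_def flip: m_assoc)
    finally show ?case by (simp add: a_minus_def a_assoc l_neg)
  next
    case (Suc k)
    then have k: "k < card J" using insert.hyps by simp
    have IH: "moore_sum k \<beta> x' ?I = y [^] (p ^ k)" using Suc by simp
    have c: "moore_sum (Suc k) \<beta> x' ?I \<in> carrier R" using \<beta> x' by simp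
    have "moore_sum k ?\<gamma> x' J = moore_sum (Suc k) \<beta> x' ?I \<ominus> ?c [^] (p ^ k) \<otimes> y [^] (p ^ k)"
      using moore_sum_as_reduce[of ?I j \<beta> x' k] \<beta> x' insert.hyps J IH by simp
    moreover have "moore_sum k ?\<gamma> x' J = (y [^] p \<ominus> ?c \<otimes> y) [^] (p ^ k)"
      using xs[OF k] \<gamma> by (subst x'J) auto
    moreover have "(y [^] p \<ominus> ?c \<otimes> y) [^] (p ^ k) = y [^] (p ^ Suc k) \<ominus> ?c [^] (p ^ k) \<otimes> y [^] (p ^ k)"
      by (simp add: frobenius_pow_minus nat_pow_distrib nat_pow_pow)
    ultimately show ?case
      using c by (auto simp: a_minus_def)
  qed
  then show ?case using x' by blast
qed

text \<open>Row 0 is left out, so there is one equation fewer than unknowns. If the rows of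
  \<open>x\<close> are \<open>z [^] (p ^ k)\<close> for \<open>k < card I\<close>, then
  \<open>\<lambda>i. x i [^] p \<ominus> x i\<close> lies here. Values outside \<open>I\<close> are
  free, so the same function can be read on a smaller index set.\<close>

definition moore_kernel :: "('i \<Rightarrow> 'a) \<Rightarrow> 'i set \<Rightarrow> ('i \<Rightarrow> 'a) set" where
  "moore_kernel \<beta> I = {d \<in> I \<rightarrow> carrier R. \<forall>k. 0 < k \<and> k < card I \<longrightarrow> moore_sum k \<beta> d I = \<zero>}"

text \<open>Reduced row \<open>k\<close> combines rows \<open>k\<close> and \<open>Suc k\<close>;
  for \<open>0 < k < card I - 1\<close> both are among the given equations.\<close>

lemma moore_kernel_restrict:
  assumes ind: "lifts_indep \<beta> I" and fin: "finite I" and j: "j \<in> I" and d: "d \<in> moore_kernel \<beta> I"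
  shows "d \<in> moore_kernel (as_reduce (\<beta> j) \<beta>) (I - {j})"
proof -
  have b: "\<beta> j \<in> carrier R" using ind j by auto
  have "moore_sum k (as_reduce (\<beta> j) \<beta>) d (I - {j}) = \<zero>" if "0 < k" "k < card (I - {j})" for k
  proof -
    have "moore_sum (Suc k) \<beta> d I = \<zero>" "moore_sum k \<beta> d I = \<zero>"
      using d that fin j unfolding moore_kernel_def by auto
    then show ?thesis
      using moore_sum_as_reduce[OF fin j, of \<beta> d k] ind d b by (simp add: moore_kernel_def a_minus_def)
  qed
  then show ?thesis using d by (auto simp: moore_kernel_def)
qed

lemma moore_kernel_extend:
  assumes ind: "lifts_indep \<beta> I" and fin: "finite I" and j: "j \<in> I"
    and d: "d \<in> moore_kernel (as_reduce (\<beta> j) \<beta>) (I - {j})"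
  shows "\<exists>e\<in>carrier R. d(j := e) \<in> moore_kernel \<beta> I"
proof -
  have u: "\<beta> j [^] p \<in> Units R" by (intro Units_pow_closed lifts_indep_unit[OF ind fin j])
  have [simp]: "\<beta> j [^] p \<in> carrier R" "\<beta> j \<in> carrier R" using u ind j by auto
  let ?s = "moore_sum (Suc 0) \<beta> d (I - {j})"
  have s [simp]: "?s \<in> carrier R" using ind d by (intro moore_sum_closed) (auto simp: moore_kernel_def)
  \<comment> \<open>\<open>e\<close> solves row 1, whose coefficient at \<open>j\<close> is the unit
    \<open>\<beta> j [^] p\<close>; the later rows follow inductively from the reduced ones.\<close>
  define e where "e = inv (\<beta> j [^] p) \<otimes> (\<ominus> ?s)"
  have e: "e \<in> carrier R" using u by (simp add: e_def)
  define f where "f = d(j := e)"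
  have fj: "f j = e" by (simp add: f_def)
  have d': "f \<in> I \<rightarrow> carrier R" using d e by (auto simp: moore_kernel_def f_def)
  have cong: "moore_sum k \<delta> f (I - {j}) = moore_sum k \<delta> d (I - {j})"
    if "\<delta> \<in> I \<rightarrow> carrier R" for k \<delta>
    using that d by (intro moore_sum_cong) (auto simp: moore_kernel_def f_def)
  have "moore_sum (Suc k) \<beta> f I = \<zero>" if "Suc k < card I" for k
    using that
  proof (induction k)
    case 0
    have "moore_sum (Suc 0) \<beta> f I = \<beta> j [^] p \<otimes> e \<oplus> ?s"
      using moore_sum_remove[OF fin j _ d', of \<beta> "Suc 0"] ind cong[of \<beta>] fj by simp
    also have "\<beta> j [^] p \<otimes> e = \<ominus> ?s" using u by (simp add: e_def flip: m_assoc)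
    finally show ?case by (simp add: l_neg)
  next
    case (Suc k)
    have "moore_sum (Suc k) (as_reduce (\<beta> j) \<beta>) f (I - {j}) = \<zero>"
      using d Suc.prems fin j ind by (subst cong) (auto simp: moore_kernel_def)
    moreover have "moore_sum (Suc k) \<beta> f I = \<zero>"
      by (rule Suc.IH) (rule Suc_lessD[OF Suc.prems])
    moreover have "moore_sum (Suc (Suc k)) \<beta> f I \<in> carrier R"
      using ind d' by (intro moore_sum_closed) auto
    ultimately show ?case
      using moore_sum_as_reduce[OF fin j _ d', of \<beta> "Suc k"] ind by (simp add: a_minus_def)
  qed
  then have "f \<in> moore_kernel \<beta> I"
    using d' unfolding moore_kernel_def by (auto simp: gr0_conv_Suc)
  then show ?thesis using e f_def by blast
qed

text \<open>Induction on \<open>I\<close>: a generator of the reduced kernel extends to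
  \<open>j\<close>, and row 1 determines the entry at \<open>j\<close> of any element by its other
  entries, so multiples stay multiples.\<close>

lemma moore_kernel_cyclic:
  assumes "finite I" "I \<noteq> {}" "lifts_indep \<beta> I"
  shows "\<exists>c \<in> moore_kernel \<beta> I. \<forall>d \<in> moore_kernel \<beta> I. \<exists>t\<in>carrier R. \<forall>i\<in>I. d i = t \<otimes> c i"
  using assms
proof (induction I arbitrary: \<beta> rule: finite_ne_induct)
  case (singleton j)
  then show ?case
    by (intro bexI[of _ "\<lambda>_. \<one>"]) (auto simp: moore_kernel_def)
next
  case (insert j J)
  let ?I = "insert j J" and ?\<gamma> = "as_reduce (\<beta> j) \<beta>"
  have \<beta>: "\<beta> \<in> ?I \<rightarrow> carrier R" using insert by simp
  have J: "?I - {j} = J" and fin: "finite ?I" and j: "j \<in> ?I" using insert.hyps by auto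
  have \<gamma>: "lifts_indep ?\<gamma> J"
    using lifts_indep_as_reduce[OF insert.prems fin j] J by simp
  have u: "\<beta> j [^] p \<in> Units R" by (intro Units_pow_closed lifts_indep_unit[OF insert.prems fin j])
  have [simp]: "\<beta> j [^] p \<in> carrier R" using u by auto
  obtain c where c: "c \<in> moore_kernel ?\<gamma> J"
    and gen: "\<And>d. d \<in> moore_kernel ?\<gamma> J \<Longrightarrow> \<exists>t\<in>carrier R. \<forall>i\<in>J. d i = t \<otimes> c i"
    using insert.IH[OF \<gamma>] by blast
  obtain e where e: "e \<in> carrier R" "c(j := e) \<in> moore_kernel \<beta> ?I"
    using moore_kernel_extend[OF insert.prems fin j] c J by auto
  let ?c = "c(j := e)"
  have "\<exists>t\<in>carrier R. \<forall>i\<in>?I. d i = t \<otimes> ?c i" if d: "d \<in> moore_kernel \<beta> ?I" for d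
  proof -
    obtain t where t: "t \<in> carrier R" "\<And>i. i \<in> J \<Longrightarrow> d i = t \<otimes> c i"
      using gen[of d] moore_kernel_restrict[OF insert.prems fin j d] J by auto
    \<comment> \<open>At least two indices, so row 1 is one of the equations.\<close>
    have one: "1 < card ?I" using insert.hyps by (simp add: card_gt_0_iff)
    have dI: "d \<in> ?I \<rightarrow> carrier R" and cI: "?c \<in> ?I \<rightarrow> carrier R"
      using d e by (auto simp: moore_kernel_def)
    have [simp]: "d j \<in> carrier R" "moore_sum (Suc 0) \<beta> c J \<in> carrier R" "e \<in> carrier R"
      using dI c \<beta> e by (auto simp: moore_kernel_def)
    have "moore_sum (Suc 0) \<beta> ?c J = moore_sum (Suc 0) \<beta> c J"
      using \<beta> c insert.hyps by (intro moore_sum_cong) (auto simp: moore_kernel_def)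
    then have ce: "\<beta> j [^] p \<otimes> e \<oplus> moore_sum (Suc 0) \<beta> c J = \<zero>"
      using moore_sum_remove[OF fin j \<beta> cI, of "Suc 0"] e(2) one J by (auto simp: moore_kernel_def)
    have "moore_sum (Suc 0) \<beta> d J = moore_sum (Suc 0) \<beta> (\<lambda>i. t \<otimes> c i) J"
      using \<beta> c t by (intro moore_sum_cong) (auto simp: moore_kernel_def)
    also have "\<dots> = t \<otimes> moore_sum (Suc 0) \<beta> c J"
      unfolding moore_sum_def using insert.hyps c t \<beta>
      by (subst finsum_rdistr) (auto intro!: finsum_cong' simp: moore_kernel_def Pi_iff m_lcomm)
    finally have "\<beta> j [^] p \<otimes> d j \<oplus> t \<otimes> moore_sum (Suc 0) \<beta> c J = \<zero>"
      using moore_sum_remove[OF fin j \<beta> dI, of "Suc 0"] d one J by (auto simp: moore_kernel_def)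
    \<comment> \<open>\<open>t \<otimes> e\<close> satisfies the same row 1 as \<open>d j\<close>;
      cancelling the unit \<open>\<beta> j [^] p\<close> identifies them.\<close>
    moreover have "\<beta> j [^] p \<otimes> (t \<otimes> e) \<oplus> t \<otimes> moore_sum (Suc 0) \<beta> c J = \<zero>"
    proof -
      have "t \<otimes> (\<beta> j [^] p \<otimes> e \<oplus> moore_sum (Suc 0) \<beta> c J) = \<zero>" using ce t by simp
      then show ?thesis using t by (simp add: r_distr m_lcomm del: One_nat_def)
    qed
    ultimately have "\<beta> j [^] p \<otimes> d j = \<beta> j [^] p \<otimes> (t \<otimes> e)"
      using t by (subst add.right_cancel[of "t \<otimes> moore_sum (Suc 0) \<beta> c J", symmetric]) auto
    then have "d j = t \<otimes> e" using u t by (simp add: Units_l_cancel)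
    then have "\<forall>i\<in>?I. d i = t \<otimes> ?c i" using t by auto
    then show ?thesis using t(1) by blast
  qed
  then show ?case using e by blast
qed

text \<open>By \<open>red\<close>, the group of index \<open>j\<close> contains the intersection of
  the others. A solution \<open>x\<close> over the other indices then extends to \<open>j\<close>,
  and the extension forces its parameter \<open>y\<close> to be of the form
  \<open>z [^] p \<ominus> \<beta> j [^] (p - 1) \<otimes> z\<close>.\<close>

lemma artin_schreier_preimage:
  assumes ind: "lifts_indep \<beta> I" and fin: "finite I" and j: "j \<in> I"
    and gen: "\<And>d. d \<in> moore_kernel \<beta> I \<Longrightarrow> \<exists>t\<in>carrier R. \<forall>i\<in>I. d i = t \<otimes> c i"
    and red: "\<And>t. t \<in> carrier R \<Longrightarrow> (\<forall>i\<in>I - {j}. \<exists>x\<in>carrier R. x [^] p \<ominus> x = t \<otimes> c i) \<Longrightarrow>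
      \<exists>x\<in>carrier R. x [^] p \<ominus> x = t \<otimes> c j"
    and two: "1 < card I" and w: "w \<in> carrier R"
  shows "\<exists>z\<in>carrier R. z [^] p \<ominus> z = w"
proof -
  let ?\<gamma> = "as_reduce (\<beta> j) \<beta>" and ?J = "I - {j}" and ?c = "\<beta> j [^] (p - 1)"
  have \<beta>: "\<beta> \<in> I \<rightarrow> carrier R" using ind by simp
  have u [simp]: "\<beta> j \<in> Units R" by (rule lifts_indep_unit[OF ind fin j])
  then have b [simp]: "\<beta> j \<in> carrier R" by (rule Units_closed)
  \<comment> \<open>Chosen so that substituting \<open>z = \<beta> j \<otimes> v\<close> at the end
    leaves \<open>v [^] p \<ominus> v = w\<close>.\<close>
  define y where "y = \<beta> j [^] p \<otimes> w"
  have y [simp]: "y \<in> carrier R" using w by (simp add: y_def)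
  have \<gamma>: "lifts_indep ?\<gamma> ?J" by (rule lifts_indep_as_reduce[OF ind fin j])
  obtain x where x: "x \<in> ?J \<rightarrow> carrier R"
    and xs: "\<And>k. k < card ?J \<Longrightarrow> moore_sum k ?\<gamma> x ?J = y [^] (p ^ k)"
    using moore_system_solvable[OF _ \<gamma> y] fin by auto
  define d where "d = (\<lambda>i. x i [^] p \<ominus> x i)"
  \<comment> \<open>The Frobenius image of row \<open>k - 1\<close> of \<open>x\<close> equals row
    \<open>k\<close>, both being \<open>y [^] (p ^ k)\<close>.\<close>
  have "moore_sum k ?\<gamma> d ?J = \<zero>" if k: "0 < k" "k < card ?J" for k
  proof -
    obtain l where l: "k = Suc l" using k by (cases k) auto
    have "moore_sum k ?\<gamma> d ?J = moore_sum l ?\<gamma> x ?J [^] p \<ominus> moore_sum k ?\<gamma> x ?J"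
      unfolding d_def l using \<gamma> x by (subst moore_sum_minus) (auto simp: moore_sum_frobenius)
    also have "\<dots> = \<zero>"
      using xs[of l] xs[of k] k l by (simp add: nat_pow_pow mult.commute)
    finally show ?thesis .
  qed
  then have "d \<in> moore_kernel ?\<gamma> ?J"
    using x by (auto simp: moore_kernel_def d_def)
  \<comment> \<open>The extension of \<open>d\<close> lies in the full kernel, hence is
    \<open>t\<close> times \<open>c\<close> on \<open>I\<close>; so \<open>t\<close> is in all
    groups but possibly the \<open>j\<close>-th, and \<open>red\<close> yields the missing root
    \<open>xj\<close>.\<close>
  then obtain e where e: "e \<in> carrier R" "d(j := e) \<in> moore_kernel \<beta> I"
    using moore_kernel_extend[OF ind fin j] by blast
  then obtain t where t: "t \<in> carrier R" "\<And>i. i \<in> I \<Longrightarrow> (d(j := e)) i = t \<otimes> c i"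
    using gen by blast
  have "\<exists>z\<in>carrier R. z [^] p \<ominus> z = t \<otimes> c i" if "i \<in> ?J" for i
    using t(2)[of i] that x by (intro bexI[of _ "x i"]) (auto simp: d_def)
  then obtain xj where xj: "xj \<in> carrier R" "xj [^] p \<ominus> xj = t \<otimes> c j"
    using red[OF t(1)] by blast
  define x' where "x' = x(j := xj)"
  have x': "x' \<in> I \<rightarrow> carrier R" using x xj by (auto simp: x'_def)
  have xd: "x' i [^] p \<ominus> x' i = (d(j := e)) i" if "i \<in> I" for i
    using that xj t(2)[OF j] by (auto simp: x'_def d_def)
  \<comment> \<open>\<open>z\<close> is row 0 of the completed solution. As row 1 vanishes on
    \<open>d(j := e)\<close>, row 1 of \<open>x'\<close> is \<open>z [^] p\<close>.\<close>
  define z where "z = moore_sum 0 \<beta> x' I"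
  have z [simp]: "z \<in> carrier R" using \<beta> x' by (simp add: z_def)
  have "z [^] p \<ominus> moore_sum (Suc 0) \<beta> x' I = moore_sum (Suc 0) \<beta> (\<lambda>i. x' i [^] p \<ominus> x' i) I"
    using \<beta> x' by (subst moore_sum_minus) (auto simp: z_def moore_sum_frobenius)
  also have "\<dots> = moore_sum (Suc 0) \<beta> (d(j := e)) I"
    using e xd \<beta> by (intro moore_sum_cong) (auto simp: moore_kernel_def)
  also have "\<dots> = \<zero>" using e two by (simp add: moore_kernel_def)
  finally have zp: "z [^] p = moore_sum (Suc 0) \<beta> x' I"
    using \<beta> x' by simp
  \<comment> \<open>Row 0 of the reduced system exists because \<open>1 < card I\<close>; it is row
    1 minus \<open>?c\<close> times row 0 of \<open>x'\<close>.\<close>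
  have "y = moore_sum 0 ?\<gamma> x ?J"
    using xs[of 0] two fin j by simp
  also have "\<dots> = moore_sum 0 ?\<gamma> x' ?J"
    by (rule moore_sum_cong[symmetric, OF _ conjunct1[OF \<gamma>] x]) (simp add: x'_def)
  also have "\<dots> = z [^] p \<ominus> ?c \<otimes> z"
    using moore_sum_as_reduce[OF fin j \<beta> x', of 0] by (simp add: zp flip: z_def)
  finally have yz: "y = z [^] p \<ominus> ?c \<otimes> z" .
  define v where "v = inv (\<beta> j) \<otimes> z"
  have v [simp]: "v \<in> carrier R" by (simp add: v_def)
  have zv: "z = \<beta> j \<otimes> v" by (simp add: v_def flip: m_assoc)
  have "?c \<otimes> \<beta> j = \<beta> j [^] p"
    using p_pos nat_pow_Suc[of "\<beta> j" "p - 1"] by simp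
  then have "?c \<otimes> z = \<beta> j [^] p \<otimes> v"
    unfolding zv by (simp flip: m_assoc)
  then have "\<beta> j [^] p \<otimes> w = \<beta> j [^] p \<otimes> (v [^] p \<ominus> v)"
    using yz by (simp add: zv nat_pow_distrib y_def r_distr r_minus a_minus_def)
  then have "v [^] p \<ominus> v = w"
    using w Units_pow_closed[OF u, of p] by (simp add: Units_l_cancel)
  then show ?thesis by (intro bexI[of _ v]) auto
qed

end

section \<open>Local rings and their residue fields\<close>

text \<open>Zorn's lemma on the ideals containing \<open>x\<close> but not \<open>\<one>\<close>;
  properness in this form passes to unions of chains.\<close>

lemma (in cring) nonunit_in_maximalideal:
  assumes x: "x \<in> carrier R" "x \<notin> Units R"
  shows "\<exists>M. maximalideal M R \<and> x \<in> M"
proof -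
  have one: "\<one> \<notin> I \<longleftrightarrow> I \<noteq> carrier R" if "ideal I R" for I
    using that ideal.one_imp_carrier by auto
  define A where "A = {I. ideal I R \<and> x \<in> I \<and> \<one> \<notin> I}"
  have "\<one> \<notin> PIdl x"
    using x by (auto simp: cgenideal_def Units_def) (metis m_comm)
  then have PA: "PIdl x \<in> A"
    using x by (simp add: A_def cgenideal_ideal cgenideal_self)
  have "\<exists>M\<in>A. \<forall>N\<in>A. M \<subseteq> N \<longrightarrow> N = M"
  proof (rule subset_Zorn_nonempty)
    show "A \<noteq> {}" using PA by blast
    fix C assume C: "C \<noteq> {}" "subset.chain A C"
    then have CA: "C \<subseteq> A" by (auto simp: pred_on.chain_def)
    have "ideal (\<Union>C) R"
    proof (rule idealI)
      show "ring R" by (rule ring_axioms)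
      show "subgroup (\<Union>C) (add_monoid R)"
      proof
        show "\<Union>C \<subseteq> carrier (add_monoid R)"
          using CA by (auto simp: A_def dest: ideal.Icarr)
        fix a b assume a: "a \<in> \<Union>C" and "b \<in> \<Union>C"
        then obtain I where "I \<in> C" "a \<in> I" "b \<in> I"
          using C(2) by (auto simp: pred_on.chain_def) blast
        then show "a \<otimes>\<^bsub>add_monoid R\<^esub> b \<in> \<Union>C"
          using CA by (auto simp: A_def intro!: bexI[of _ I] additive_subgroup.a_closed ideal.axioms(1))
      next
        show "\<one>\<^bsub>add_monoid R\<^esub> \<in> \<Union>C"
          using CA C(1) by (auto simp: A_def intro!: additive_subgroup.zero_closed ideal.axioms(1))
      next
        fix a assume "a \<in> \<Union>C"
        then show "inv\<^bsub>add_monoid R\<^esub> a \<in> \<Union>C"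
          using CA by (auto simp: A_def simp flip: a_inv_def
              intro!: additive_subgroup.a_inv_closed ideal.axioms(1))
      qed
    next
      fix a b assume "a \<in> \<Union>C" "b \<in> carrier R"
      then show "b \<otimes> a \<in> \<Union>C" "a \<otimes> b \<in> \<Union>C"
        using CA by (auto simp: A_def dest: ideal.I_l_closed ideal.I_r_closed)
    qed
    then show "\<Union>C \<in> A"
      using CA C(1) by (auto simp: A_def)
  qed
  then obtain M where M: "M \<in> A" "\<And>N. N \<in> A \<Longrightarrow> M \<subseteq> N \<Longrightarrow> N = M"
    by blast
  have "maximalideal M R"
  proof (rule maximalidealI)
    show "ideal M R" "carrier R \<noteq> M" using M one by (auto simp: A_def)
    fix J assume J: "ideal J R" "M \<subseteq> J" "J \<subseteq> carrier R"
    then show "J = M \<or> J = carrier R"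
      using M one by (auto simp: A_def)
  qed
  then show ?thesis using M by (auto simp: A_def)
qed

text \<open>A nonunit lies in some maximal ideal, which is \<open>\<mm>\<close> by
  uniqueness.\<close>

lemma local_ring_unit:
  assumes "local_ring R" "maximalideal \<mm> R" "x \<in> carrier R" "x \<notin> \<mm>"
  shows "x \<in> Units R"
proof (rule ccontr)
  assume "x \<notin> Units R"
  then obtain M where "maximalideal M R" "x \<in> M"
    using assms cring.nonunit_in_maximalideal[of R x] unfolding local_ring_def by blast
  then show False using assms unfolding local_ring_def by blast
qed

text \<open>Scalars add modulo \<open>n\<close>, so induction on \<open>k\<close> identifies
  \<open>[k] \<cdot> \<one>\<close> with the scalar \<open>k mod n\<close> acting on
  \<open>\<one>\<close>; at \<open>k = n\<close> this is the scalar 0.\<close>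

lemma algebra_residue_ring_char:
  fixes R (structure)
  assumes alg: "algebra (residue_ring (int n)) R" and n: "1 < n"
  shows "[n] \<cdot> \<one> = \<zero>"
proof -
  interpret algebra "residue_ring (int n)" R by fact
  interpret R: cring R by unfold_locales
  have l: "((a + b) mod int n) \<odot> \<one> = a \<odot> \<one> \<oplus> b \<odot> \<one>"
    if "a \<in> {0..int n - 1}" "b \<in> {0..int n - 1}" for a b
    using smult_l_distr[of a b \<one>] that by (simp add: residue_ring_def)
  have one: "1 \<odot> \<one> = \<one>"
    using smult_one[of \<one>] by (simp add: residue_ring_def)
  have zero: "0 \<odot> \<one> = \<zero>"
  proof -
    have "0 \<odot> \<one> \<in> carrier R"
      using smult_closed[of 0 \<one>] n by (simp add: residue_ring_def)
    moreover have "0 \<odot> \<one> = 0 \<odot> \<one> \<oplus> 0 \<odot> \<one>"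
      using l[of 0 0] n by simp
    ultimately show ?thesis by (simp add: M.add.l_cancel_one')
  qed
  have "[k] \<cdot> \<one> = int (k mod n) \<odot> \<one>" for k
  proof (induction k)
    case 0
    then show ?case using zero by simp
  next
    case (Suc k)
    have "int (Suc k mod n) = (int (k mod n) + 1) mod int n"
      by (simp only: zmod_int of_nat_Suc mod_add_left_eq add.commute[of 1])
    moreover have "(int (k mod n) + 1) mod int n \<odot> \<one> = int (k mod n) \<odot> \<one> \<oplus> 1 \<odot> \<one>"
    proof (rule l)
      have "k mod n < n" using n by simp
      then show "int (k mod n) \<in> {0..int n - 1}" by (simp only: atLeastAtMost_iff) linarith
    qed (use n in auto)
    ultimately show ?case using Suc.IH one by simp
  qed
  from this[of n] show ?thesis using zero by simp
qed

lemma (in cring) residue_char_pI: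
  assumes p: "Factorial_Ring.prime p" and char: "[p] \<cdot> \<one> = \<zero>"
    and loc: "local_ring R" and mm: "maximalideal \<mm> R"
  shows "residue_char_p R (R Quot \<mm>) p ((+>) \<mm>)"
proof -
  interpret maximalideal \<mm> R by fact
  interpret S: field "R Quot \<mm>" by (rule quotient_is_field) (rule is_cring)
  interpret h: ring_hom_cring R "R Quot \<mm>" "(+>) \<mm>"
    by unfold_locales (rule rcos_ring_hom)
  have "[k] \<cdot>\<^bsub>R Quot \<mm>\<^esub> (\<mm> +> \<one>) = \<mm> +> ([k] \<cdot> \<one>)" for k :: nat
  proof (induction k)
    case 0
    show ?case by (simp only: add.nat_pow_0 S.add.nat_pow_0 h.hom_zero)
  next
    case (Suc k)
    then show ?case
      by (simp only: add.nat_pow_Suc S.add.nat_pow_Suc h.hom_add add.nat_pow_closed one_closed)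
  qed
  from this[of p] have "[p] \<cdot>\<^bsub>R Quot \<mm>\<^esub> \<one>\<^bsub>R Quot \<mm>\<^esub> = \<zero>\<^bsub>R Quot \<mm>\<^esub>"
    using char by (simp only: h.hom_one h.hom_zero)
  moreover have "x \<in> Units R" if "x \<in> carrier R" "\<mm> +> x \<noteq> \<zero>\<^bsub>R Quot \<mm>\<^esub>" for x
  proof (rule local_ring_unit[OF loc mm that(1)])
    show "x \<notin> \<mm>"
    proof
      assume "x \<in> \<mm>"
      then have "\<mm> +> x = \<mm>" by (rule a_rcos_const)
      also have "\<dots> = \<mm> +> \<zero>"
        by (rule a_rcos_const[symmetric]) (rule additive_subgroup.zero_closed[OF is_additive_subgroup])
      also have "\<dots> = \<zero>\<^bsub>R Quot \<mm>\<^esub>" by (rule h.hom_zero)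
      finally show False using that(2) by (rule notE[rotated])
    qed
  qed
  ultimately show ?thesis
    by unfold_locales (use p char in \<open>blast+\<close>)
qed

section \<open>Artin--Schreier images in NIP rings\<close>

text \<open>\<open>NIP_theory\<close> ranges over plain ring records, while an algebra carries more
  fields; satisfaction sees only the ring operations.\<close>

lemma sat_truncate:
  "tval \<lparr>carrier = carrier R, monoid.mult = monoid.mult R, one = one R, zero = zero R, add = add R\<rparr> e t = tval R e t"
  "sat \<lparr>carrier = carrier R, monoid.mult = monoid.mult R, one = one R, zero = zero R, add = add R\<rparr> e' \<phi> = sat R e' \<phi>"
proof -
  let ?M = "\<lparr>carrier = carrier R, monoid.mult = monoid.mult R, one = one R, zero = zero R, add = add R\<rparr>"
  have inv: "a_inv ?M x = a_inv R x" for x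
    by (simp add: a_inv_def m_inv_def)
  have t: "tval ?M e t = tval R e t" for e t
    by (induction t) (simp_all add: inv)
  show "tval ?M e t = tval R e t" by (rule t)
  show "sat ?M e' \<phi> = sat R e' \<phi>"
    by (induction \<phi> arbitrary: e') (simp_all add: t)
qed

text \<open>\<open>R\<close>, truncated to a plain ring record, is a model of its own
  theory.\<close>

lemma NIP_ring_not_IP:
  assumes R: "NIP_ring R" and \<phi>: "fvars \<phi> \<subseteq> {..<k + l}"
  shows "\<not> has_IP R \<phi> k l"
proof -
  let ?M = "\<lparr>carrier = carrier R, monoid.mult = monoid.mult R, one = one R, zero = zero R, add = add R\<rparr>"
  interpret cring R using R by (simp add: NIP_ring_def)
  have "cring ?M"
  proof (intro cringI abelian_groupI comm_monoidI)
    fix x assume "x \<in> carrier ?M"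
    then show "\<exists>y\<in>carrier ?M. y \<oplus>\<^bsub>?M\<^esub> x = \<zero>\<^bsub>?M\<^esub>"
      by (intro bexI[of _ "\<ominus>\<^bsub>R\<^esub> x"]) (auto simp: l_neg)
  qed (auto simp: a_assoc m_assoc l_distr intro: a_comm m_comm)
  then have "is_model ?M (ring_theory R)"
    by (simp add: is_model_def ring_theory_def sat_truncate)
  then have "\<not> has_IP ?M \<phi> k l"
    using R \<phi> unfolding NIP_ring_def NIP_theory_def by blast
  moreover have "has_IP ?M \<phi> k l = has_IP R \<phi> k l"
    by (simp add: has_IP_def tuples_def sat_truncate)
  ultimately show ?thesis by simp
qed

primrec pow_term :: "ring_term \<Rightarrow> nat \<Rightarrow> ring_term" where
  "pow_term t 0 = One"
| "pow_term t (Suc n) = Mul (pow_term t n) t"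

text \<open>Variable 0 is the object \<open>c\<close>, variable 1 the parameter \<open>t\<close>,
  variable 2 the bound root; as \<open>p\<close> is fixed, the power is a term.\<close>

definition as_form :: "nat \<Rightarrow> ring_form" where
  "as_form p = FEx 2 (FEq (Add (pow_term (Var 2) p) (Neg (Var 2))) (Mul (Var 0) (Var 1)))"

lemma fvars_as_form: "fvars (as_form p) \<subseteq> {..<1 + 1}"
proof -
  have "tvars (pow_term (Var 2) n) \<subseteq> {2}" for n by (induction n) auto
  then show ?thesis by (auto simp: as_form_def)
qed

lemma sat_as_form:
  "sat R ((!) ([c] @ [t])) (as_form p) \<longleftrightarrow> (\<exists>x\<in>carrier R. x [^]\<^bsub>R\<^esub> p \<ominus>\<^bsub>R\<^esub> x = c \<otimes>\<^bsub>R\<^esub> t)"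
proof -
  have "tval R e (pow_term s n) = tval R e s [^]\<^bsub>R\<^esub> n" for e s n
    by (induction n) (simp_all add: nat_pow_def)
  then show ?thesis by (simp add: as_form_def a_minus_def)
qed

section \<open>The additive group of Artin-Schreier values and shattering\<close>

context prime_char_cring
begin

definition as_image :: "'a set" where
  "as_image = {x [^] p \<ominus> x |x. x \<in> carrier R}"

lemma as_image_iff: "y \<in> as_image \<longleftrightarrow> (\<exists>x\<in>carrier R. x [^] p \<ominus> x = y)"
  unfolding as_image_def by blast

lemma as_image_carrier: "as_image \<subseteq> carrier R"
  unfolding as_image_def by auto

lemma as_image_zero: "\<zero> \<in> as_image"
  unfolding as_image_iff by (intro bexI[of _ \<zero>]) (auto simp: nat_pow_zero a_minus_def)

lemma as_image_add:
  assumes "a \<in> as_image" "b \<in> as_image"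
  shows "a \<oplus> b \<in> as_image"
proof -
  obtain x y where "x \<in> carrier R" "y \<in> carrier R" "a = x [^] p \<ominus> x" "b = y [^] p \<ominus> y"
    using assms unfolding as_image_def by blast
  then show ?thesis
    unfolding as_image_iff
    by (intro bexI[of _ "x \<oplus> y"]) (auto simp: frobenius_add a_minus_def minus_add a_ac)
qed

lemma as_image_a_inv:
  assumes "a \<in> as_image"
  shows "\<ominus> a \<in> as_image"
proof -
  obtain x where x: "x \<in> carrier R" "a = x [^] p \<ominus> x"
    using assms unfolding as_image_def by blast
  have "(\<zero> \<ominus> x) [^] p = \<zero> [^] p \<ominus> x [^] p"
    using x by (intro frobenius_minus) auto
  then show ?thesis
    using x unfolding as_image_iff
    by (intro bexI[of _ "\<ominus> x"]) (auto simp: a_minus_def nat_pow_zero minus_add)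
qed

lemma as_image_finsum:
  assumes "\<And>i. i \<in> A \<Longrightarrow> f i \<in> as_image"
  shows "(\<Oplus>i\<in>A. f i) \<in> as_image"
  using assms
proof (induction A rule: infinite_finite_induct)
  case (insert i A)
  then have "f \<in> A \<rightarrow> carrier R" "f i \<in> carrier R" using as_image_carrier by auto
  then show ?case using insert by (simp add: as_image_add)
qed (auto simp: as_image_zero)

text \<open>The Baldwin--Saxl argument: sums of the \<open>t j\<close> shatter the subgroups \<open>{s. c i \<otimes> s \<in> as_image}\<close>.\<close>

lemma as_image_shatter:
  assumes fin: "finite I"
    and c: "\<And>i. i \<in> I \<Longrightarrow> c i \<in> carrier R" and tc: "\<And>j. j \<in> I \<Longrightarrow> t j \<in> carrier R"
    and off: "\<And>i j. i \<in> I \<Longrightarrow> j \<in> I \<Longrightarrow> i \<noteq> j \<Longrightarrow> t j \<otimes> c i \<in> as_image"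
    and diag: "\<And>i. i \<in> I \<Longrightarrow> t i \<otimes> c i \<notin> as_image"
  shows "\<exists>s\<in>carrier R. \<forall>i\<in>I. c i \<otimes> s \<in> as_image \<longleftrightarrow> i \<in> A"
proof -
  define s where "s = (\<Oplus>j\<in>I - A. t j)"
  have s: "s \<in> carrier R" unfolding s_def using tc by (intro finsum_closed) auto
  have cs: "c i \<otimes> s = (\<Oplus>j\<in>I - A. t j \<otimes> c i)" if i: "i \<in> I" for i
  proof -
    have "s \<otimes> c i = (\<Oplus>j\<in>I - A. t j \<otimes> c i)"
      unfolding s_def using c[OF i] tc fin by (intro finsum_ldistr) auto
    then show ?thesis using m_comm[OF c[OF i] s] by simp
  qed
  have "c i \<otimes> s \<in> as_image \<longleftrightarrow> i \<in> A" if i: "i \<in> I" for i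
  proof (cases "i \<in> A")
    case True
    then have "(\<Oplus>j\<in>I - A. t j \<otimes> c i) \<in> as_image"
      using off i by (intro as_image_finsum) auto
    then show ?thesis using True cs[OF i] by simp
  next
    case False
    \<comment> \<open>Only the summand \<open>j = i\<close> can leave the subgroup; the rest
      \<open>r\<close> lies in it, so \<open>c i \<otimes> s\<close> is in the subgroup exactly if
      \<open>t i \<otimes> c i\<close> is.\<close>
    define r where "r = (\<Oplus>j\<in>I - A - {i}. t j \<otimes> c i)"
    have r: "r \<in> as_image" unfolding r_def using off i by (intro as_image_finsum) auto
    then have rc: "r \<in> carrier R" using as_image_carrier by auto
    have ti: "t i \<otimes> c i \<in> carrier R" using tc[OF i] c[OF i] by simp
    have "(\<Oplus>j\<in>insert i (I - A - {i}). t j \<otimes> c i) = t i \<otimes> c i \<oplus> r"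
      unfolding r_def using tc i c[OF i] fin by (intro finsum_insert) auto
    moreover have "insert i (I - A - {i}) = I - A" using False i by auto
    ultimately have "c i \<otimes> s = t i \<otimes> c i \<oplus> r" using cs[OF i] by simp
    then have "c i \<otimes> s \<oplus> \<ominus> r = t i \<otimes> c i"
      using rc ti by (simp add: a_assoc r_neg)
    then have "c i \<otimes> s \<notin> as_image"
      using diag[OF i] as_image_add as_image_a_inv[OF r] by metis
    then show ?thesis using False by simp
  qed
  then show ?thesis using s by blast
qed

end

text \<open>A value \<open>w\<close> outside the image would make every group irredundant, for
  arbitrarily many groups; the resulting elements \<open>t j\<close> let \<open>as_form\<close>
  shatter sets of any size, against NIP.\<close>

lemma (in residue_char_p) NIP_artin_schreier_surj:
  assumes inf: "infinite (carrier S)" and surj: "carrier S \<subseteq> h ` carrier R"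
    and nip: "NIP_ring R"
  shows "carrier R \<subseteq> as_image"
proof (rule ccontr)
  assume "\<not> ?thesis"
  then obtain w where w: "w \<in> carrier R" "w \<notin> as_image" by blast
  have "\<exists>a. (\<forall>i<n. a i \<in> tuples R 1) \<and> (\<forall>A. A \<subseteq> {..<n} \<longrightarrow>
        (\<exists>b\<in>tuples R 1. \<forall>i<n. sat R ((!) (a i @ b)) (as_form p) \<longleftrightarrow> i \<in> A))" for n :: nat
  proof -
    \<comment> \<open>Two spare indices guarantee \<open>1 < card ?I\<close>, also for
      \<open>n = 0\<close>; the pattern of size \<open>n\<close> is read off the first
      \<open>n\<close>.\<close>
    let ?I = "{..<n + 2}"
    obtain b where b: "b \<in> ?I \<rightarrow> carrier S" "S.fp_indep b ?I"
      using S.exists_fp_indep[OF inf] by blast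
    have "\<exists>x. x \<in> carrier R \<and> h x = b i" if "i \<in> ?I" for i
    proof -
      have "b i \<in> h ` carrier R" using Pi_mem[OF b(1) that] surj by (rule rev_subsetD)
      then show ?thesis by (metis imageE)
    qed
    then obtain \<beta> where \<beta>: "\<And>i. i \<in> ?I \<Longrightarrow> \<beta> i \<in> carrier R \<and> h (\<beta> i) = b i" by metis
    have "S.fp_indep (h \<circ> \<beta>) ?I"
    proof (rule S.fp_indep_cong[OF b(2) _ b(1)])
      show "(h \<circ> \<beta>) i = b i" if "i \<in> ?I" for i
        using \<beta>[OF that] by (simp only: comp_apply)
    qed
    moreover have "\<beta> \<in> ?I \<rightarrow> carrier R" using \<beta> by blast
    ultimately have ind: "lifts_indep \<beta> ?I" by blast
    have "?I \<noteq> {}" by (simp add: lessThan_empty_iff)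
    then obtain c where c: "c \<in> moore_kernel \<beta> ?I"
      and gen: "\<And>d. d \<in> moore_kernel \<beta> ?I \<Longrightarrow> \<exists>t\<in>carrier R. \<forall>i\<in>?I. d i = t \<otimes> c i"
      using moore_kernel_cyclic[OF finite_lessThan _ ind] by blast
    have cc: "c i \<in> carrier R" if "i \<in> ?I" for i
      using c that unfolding moore_kernel_def by blast
    \<comment> \<open>If the group at \<open>j\<close> contained the intersection of the others,
      \<open>artin_schreier_preimage\<close> would put \<open>w\<close> into the image.\<close>
    have "\<exists>t. t \<in> carrier R \<and> (\<forall>i\<in>?I - {j}. t \<otimes> c i \<in> as_image) \<and> t \<otimes> c j \<notin> as_image"
      if j: "j \<in> ?I" for j
    proof (rule ccontr)
      assume neg: "\<not> ?thesis"
      have "\<exists>z\<in>carrier R. z [^] p \<ominus> z = w"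
      proof (rule artin_schreier_preimage[OF ind finite_lessThan j gen _ _ w(1)])
        fix t assume t: "t \<in> carrier R" "\<forall>i\<in>?I - {j}. \<exists>x\<in>carrier R. x [^] p \<ominus> x = t \<otimes> c i"
        then show "\<exists>x\<in>carrier R. x [^] p \<ominus> x = t \<otimes> c j"
          using neg unfolding as_image_iff by blast
      qed simp_all
      then show False using w(2) unfolding as_image_iff by blast
    qed
    then obtain t where t: "\<And>j. j \<in> ?I \<Longrightarrow>
        t j \<in> carrier R \<and> (\<forall>i\<in>?I - {j}. t j \<otimes> c i \<in> as_image) \<and> t j \<otimes> c j \<notin> as_image"
      by metis
    have sat: "sat R ((!) ([c i] @ [s])) (as_form p) \<longleftrightarrow> c i \<otimes> s \<in> as_image" for i s
      unfolding sat_as_form as_image_iff ..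
    have tuple: "[x] \<in> tuples R 1 \<longleftrightarrow> x \<in> carrier R" for x
      by (simp add: tuples_def)
    have "\<exists>b\<in>tuples R 1. \<forall>i<n. sat R ((!) ([c i] @ b)) (as_form p) \<longleftrightarrow> i \<in> A" for A
    proof -
      have "\<exists>s\<in>carrier R. \<forall>i\<in>?I. c i \<otimes> s \<in> as_image \<longleftrightarrow> i \<in> A"
        by (rule as_image_shatter[OF finite_lessThan, where t = t]) (use cc t in blast)+
      then obtain s where s: "s \<in> carrier R" "\<And>i. i \<in> ?I \<Longrightarrow> c i \<otimes> s \<in> as_image \<longleftrightarrow> i \<in> A"
        by blast
      have "\<forall>i<n. c i \<otimes> s \<in> as_image \<longleftrightarrow> i \<in> A"
        using s(2) by simp
      then show ?thesis
        using s(1) by (intro bexI[of _ "[s]"]) (simp_all only: sat tuple)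
    qed
    moreover have "\<forall>i<n. [c i] \<in> tuples R 1"
      unfolding tuple using cc by simp
    ultimately show ?thesis
      by (intro exI[of _ "\<lambda>i. [c i]"] conjI allI impI) blast+
  qed
  then have "has_IP R (as_form p) 1 1"
    unfolding has_IP_def by blast
  then show False
    using NIP_ring_not_IP[OF nip fvars_as_form] by blast
qed

theorem theorem3p4:
  fixes p :: nat and R :: "(int, 'a, 'b) module_scheme" and \<mm> :: "'a set"
  assumes "Factorial_Ring.prime p"
    and "algebra (residue_ring (int p)) R"
    and "NIP_ring R"
    and "domain R"
    and "local_ring R"
    and "maximalideal \<mm> R"
    and "infinite (carrier (R Quot \<mm>))"
  shows "(\<lambda>x. x [^]\<^bsub>R\<^esub> p \<ominus>\<^bsub>R\<^esub> x) ` carrier R = carrier R"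
proof -
  interpret cring R using assms(3) by (simp add: NIP_ring_def)
  have char: "[p] \<cdot>\<^bsub>R\<^esub> \<one>\<^bsub>R\<^esub> = \<zero>\<^bsub>R\<^esub>"
    using assms(1,2) by (intro algebra_residue_ring_char prime_gt_1_nat)
  interpret residue_char_p R "R Quot \<mm>" p "(+>\<^bsub>R\<^esub>) \<mm>"
    by (rule residue_char_pI[OF assms(1) char assms(5,6)])
  have "carrier (R Quot \<mm>) \<subseteq> (+>\<^bsub>R\<^esub>) \<mm> ` carrier R"
    unfolding FactRing_def A_RCOSETS_def' by auto
  from NIP_artin_schreier_surj[OF assms(7) this assms(3)]
  have "carrier R \<subseteq> as_image" .
  then show ?thesis using as_image_carrier unfolding as_image_def by blast
qed

end
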